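(* There is a polynomial-time algorithm that, given a Maker-Breaker poset positional game $(X,\mathcal{F},P)$ in which $P$ has height at most $2$ and $\mathcal{F}=\{\{x\}\}$ consists of a single winning set of size $1$, decides which player (Maker or Breaker) has a winning strategy when Maker starts.
   Context: A poset positional game is a triple $(X,\mathcal{F},P)$ with $X$ a finite board of vertices, $\mathcal{F}\subseteq 2^X$ the winning sets, and $P$ a partial order on $X$. Two players alternately claim an unclaimed vertex $v$ such that all vertices smaller than $v$ in $P$ are already claimed, until all vertices are claimed. In the Maker-Breaker convention, Maker wins if at some point she has claimed all vertices of some winning set; otherwise Breaker wins. The height of a poset is the cardinality of its longest chain (set of pairwise comparable elements). *)

theory Defs
  imports "HOL-Computational_Algebra.Polynomial"
begin

text \<open>A partial order is a reflexive relation in the sense of \<^const>\<open>partial_order_on\<close>;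
  a pair \<open>(u, v) \<in> P\<close> means that \<open>u\<close> is below or equal to \<open>v\<close>.\<close>

definition poset_positional_game :: "'a set \<Rightarrow> 'a set set \<Rightarrow> ('a \<times> 'a) set \<Rightarrow> bool" where
  "poset_positional_game X F P \<longleftrightarrow>
     finite X \<and> F \<subseteq> Pow X \<and> P \<subseteq> X \<times> X \<and> partial_order_on X P"

definition poset_height :: "('a \<times> 'a) set \<Rightarrow> nat" where
  "poset_height P = Max (card ` Chains P)"

datatype player = Maker | Breaker

fun opponent :: "player \<Rightarrow> player" where
  "opponent Maker = Breaker"
| "opponent Breaker = Maker"

text \<open>A play is recorded as the list of the claimed vertices, in the order in which they were
  claimed. The player \<open>s\<close> who starts makes the moves with even index.\<close>

definition mover :: "player \<Rightarrow> nat \<Rightarrow> player" where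
  "mover s i = (if even i then s else opponent s)"

definition legal_move :: "'a set \<Rightarrow> ('a \<times> 'a) set \<Rightarrow> 'a list \<Rightarrow> 'a \<Rightarrow> bool" where
  "legal_move X P h v \<longleftrightarrow> v \<in> X \<and> v \<notin> set h \<and> (\<forall>u. (u, v) \<in> P \<and> u \<noteq> v \<longrightarrow> u \<in> set h)"

definition legal_play :: "'a set \<Rightarrow> ('a \<times> 'a) set \<Rightarrow> 'a list \<Rightarrow> bool" where
  "legal_play X P h \<longleftrightarrow> (\<forall>i < length h. legal_move X P (take i h) (h ! i))"

definition claimed_by :: "player \<Rightarrow> player \<Rightarrow> 'a list \<Rightarrow> 'a set" where
  "claimed_by s p h = {h ! i | i. i < length h \<and> mover s i = p}"

definition maker_wins_play :: "'a set set \<Rightarrow> player \<Rightarrow> 'a list \<Rightarrow> bool" where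
  "maker_wins_play F s h \<longleftrightarrow> (\<exists>k \<le> length h. \<exists>W \<in> F. W \<subseteq> claimed_by s Maker (take k h))"

fun wins_play :: "'a set set \<Rightarrow> player \<Rightarrow> player \<Rightarrow> 'a list \<Rightarrow> bool" where
  "wins_play F s Maker h \<longleftrightarrow> maker_wins_play F s h"
| "wins_play F s Breaker h \<longleftrightarrow> \<not> maker_wins_play F s h"

definition follows :: "player \<Rightarrow> player \<Rightarrow> ('a list \<Rightarrow> 'a) \<Rightarrow> 'a list \<Rightarrow> bool" where
  "follows s p \<sigma> h \<longleftrightarrow> (\<forall>i < length h. mover s i = p \<longrightarrow> h ! i = \<sigma> (take i h))"

definition has_winning_strategy ::
    "'a set \<Rightarrow> 'a set set \<Rightarrow> ('a \<times> 'a) set \<Rightarrow> player \<Rightarrow> player \<Rightarrow> bool" where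
  "has_winning_strategy X F P s p \<longleftrightarrow>
     (\<exists>\<sigma>. (\<forall>h. legal_play X P h \<and> follows s p \<sigma> h \<and> set h \<noteq> X \<and> mover s (length h) = p
               \<longrightarrow> legal_move X P h (\<sigma> h)) \<and>
          (\<forall>h. legal_play X P h \<and> follows s p \<sigma> h \<and> set h = X \<longrightarrow> wins_play F s p h))"

text \<open>The board is listed as \<open>vs\<close> and the family of winning sets as \<open>Ws\<close>. The two lengths are
  given in unary; they are followed by the characteristic vectors of the winning sets and the
  matrix of the order relation, all with respect to the listing \<open>vs\<close>. The vertex names
  themselves are not part of the input.\<close>

definition unary :: "nat \<Rightarrow> bool list" where
  "unary n = replicate n True @ [False]"

definition encode_game :: "'a list \<Rightarrow> 'a set list \<Rightarrow> ('a \<times> 'a) set \<Rightarrow> bool list" where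
  "encode_game vs Ws P =
     unary (length vs) @ unary (length Ws) @
     concat (map (\<lambda>W. map (\<lambda>v. v \<in> W) vs) Ws) @
     concat (map (\<lambda>u. map (\<lambda>v. (u, v) \<in> P) vs) vs)"

definition game_encoding :: "'a set \<Rightarrow> 'a set set \<Rightarrow> ('a \<times> 'a) set \<Rightarrow> bool list \<Rightarrow> bool" where
  "game_encoding X F P w \<longleftrightarrow>
     (\<exists>vs Ws. distinct vs \<and> set vs = X \<and> distinct Ws \<and> set Ws = F \<and> w = encode_game vs Ws P)"

text \<open>States and tape symbols are initial segments of the natural numbers. Symbol \<open>0\<close> is the
  blank; \<open>1\<close> and \<open>2\<close> represent the input bits. Tapes are infinite in both directions; a tape is
  given by its contents and the position of its head.\<close>

datatype move = Go_Left | Stay | Go_Right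

type_synonym tape = "(int \<Rightarrow> nat) \<times> int"
type_synonym config = "nat \<times> tape list"

record tm =
  num_tapes :: nat
  num_states :: nat
  num_symbols :: nat
  start_state :: nat
  accept_state :: nat
  reject_state :: nat
  trans :: "nat \<Rightarrow> nat list \<Rightarrow> nat \<times> (nat \<times> move) list"

text \<open>Only the finitely many values of the transition function on existing states and symbols
  matter, since these are closed under transitions.\<close>

definition turing_machine :: "tm \<Rightarrow> bool" where
  "turing_machine M \<longleftrightarrow>
     num_tapes M \<ge> 1 \<and> num_symbols M \<ge> 3 \<and>
     start_state M < num_states M \<and> accept_state M < num_states M \<and>
     reject_state M < num_states M \<and> accept_state M \<noteq> reject_state M \<and>
     (\<forall>q as q' acts. q < num_states M \<and> length as = num_tapes M \<and>
        (\<forall>a \<in> set as. a < num_symbols M) \<and> trans M q as = (q', acts) \<longrightarrow>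
        q' < num_states M \<and> length acts = num_tapes M \<and>
        (\<forall>(b, m) \<in> set acts. b < num_symbols M))"

fun shift :: "move \<Rightarrow> int \<Rightarrow> int" where
  "shift Go_Left i = i - 1"
| "shift Stay i = i"
| "shift Go_Right i = i + 1"

fun act :: "nat \<times> move \<Rightarrow> tape \<Rightarrow> tape" where
  "act (b, m) (t, i) = (t(i := b), shift m i)"

definition halted :: "tm \<Rightarrow> config \<Rightarrow> bool" where
  "halted M c \<longleftrightarrow> fst c \<in> {accept_state M, reject_state M}"

definition tm_step :: "tm \<Rightarrow> config \<Rightarrow> config" where
  "tm_step M c =
     (if halted M c then c
      else let (q', acts) = trans M (fst c) (map (\<lambda>(t, i). t i) (snd c))
           in (q', map2 act acts (snd c)))"

definition input_tape :: "bool list \<Rightarrow> tape" where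
  "input_tape w =
     (\<lambda>i. if 0 \<le> i \<and> i < int (length w) then (if w ! nat i then 2 else 1) else 0, 0)"

definition initial_config :: "tm \<Rightarrow> bool list \<Rightarrow> config" where
  "initial_config M w = (start_state M, input_tape w # replicate (num_tapes M - 1) (\<lambda>_. 0, 0))"

definition config_after :: "tm \<Rightarrow> bool list \<Rightarrow> nat \<Rightarrow> config" where
  "config_after M w t = (tm_step M ^^ t) (initial_config M w)"

definition halts_within :: "tm \<Rightarrow> bool list \<Rightarrow> nat \<Rightarrow> bool" where
  "halts_within M w t \<longleftrightarrow> halted M (config_after M w t)"

definition accepts :: "tm \<Rightarrow> bool list \<Rightarrow> bool" where
  "accepts M w \<longleftrightarrow> (\<exists>t. fst (config_after M w t) = accept_state M)"

definition rejects :: "tm \<Rightarrow> bool list \<Rightarrow> bool" where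
  "rejects M w \<longleftrightarrow> (\<exists>t. fst (config_after M w t) = reject_state M)"

end

theory Submission
  imports Defs
begin

text \<open>Let \<open>D\<close> be the set of vertices strictly below \<open>x\<close>. Whoever claims the last vertex of \<open>D\<close> hands
  \<open>x\<close> to the opponent, so nobody claims it before being forced to. If this last vertex is \<open>u\<close>, the
  vertices claimed before it are exactly those not above or equal to \<open>u\<close>, hence the parity of their
  number determines the loser. So each \<open>u \<in> D\<close> favours one of the players. As the poset has height at
  most 2, all of \<open>D\<close> is available from the start, and each player removes the vertices favouring
  the other: the majority wins, and a tie goes to the player to move. The number of vertices not
  above or equal to \<open>u\<close> is the number of zeros in row \<open>u\<close> of the order matrix, so the majority can
  be determined in one pass over the input.\<close>

section \<open>The winner of the game\<close>

lemma opponent_neq [simp]: "opponent p \<noteq> p" "p \<noteq> opponent p"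
  by (cases p; simp)+

lemma legal_play_Nil [simp]: "legal_play X P []"
  by (simp add: legal_play_def)

lemma legal_play_snoc:
  "legal_play X P (h @ [v]) \<longleftrightarrow> legal_play X P h \<and> legal_move X P h v"
  by (auto simp: legal_play_def less_Suc_eq nth_append)

lemma follows_Nil [simp]: "follows s p \<sigma> []"
  by (simp add: follows_def)

lemma follows_snoc:
  "follows s p \<sigma> (h @ [v]) \<longleftrightarrow> follows s p \<sigma> h \<and> (mover s (length h) = p \<longrightarrow> v = \<sigma> h)"
  by (auto simp: follows_def less_Suc_eq nth_append)

lemma claimed_by_snoc:
  "claimed_by s p (h @ [v]) = claimed_by s p h \<union> (if mover s (length h) = p then {v} else {})"
proof -
  have "claimed_by s p (h @ [v]) = (\<lambda>i. (h @ [v]) ! i) ` {i. i < Suc (length h) \<and> mover s i = p}"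
    by (auto simp: claimed_by_def)
  also have "{i. i < Suc (length h) \<and> mover s i = p} =
      {i. i < length h \<and> mover s i = p} \<union> (if mover s (length h) = p then {length h} else {})"
    by (auto simp: less_Suc_eq)
  finally show ?thesis
    by (auto simp: claimed_by_def nth_append image_iff)
qed

lemma mover_Suc: "mover s (Suc i) = opponent (mover s i)"
  by (cases s) (auto simp: mover_def)

lemma legal_play_subset: "legal_play X P h \<Longrightarrow> set h \<subseteq> X"
  by (induction h rule: rev_induct) (auto simp: legal_play_snoc legal_move_def)

lemma legal_play_distinct: "legal_play X P h \<Longrightarrow> distinct h"
  by (induction h rule: rev_induct) (auto simp: legal_play_snoc legal_move_def)

lemma legal_play_down_closed:
  "legal_play X P h \<Longrightarrow> v \<in> set h \<Longrightarrow> (u, v) \<in> P \<Longrightarrow> u \<in> set h"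
  by (induction h arbitrary: v rule: rev_induct) (auto simp: legal_play_snoc legal_move_def)

text \<open>Passing to an unclaimed vertex strictly below \<open>y\<close> shrinks the down-set, so
  the descent ends at a legal move. That it lies below \<open>y\<close> is what determines the
  position once a single legal move is left.\<close>

lemma legal_move_below:
  assumes "finite X" "P \<subseteq> X \<times> X" "partial_order_on X P" "y \<in> X - set h"
  shows "\<exists>z. legal_move X P h z \<and> (z, y) \<in> P"
  using assms(4)
proof (induction "card {w. (w, y) \<in> P}" arbitrary: y rule: less_induct)
  case less
  show ?case
  proof (cases "legal_move X P h y")
    case True
    then show ?thesis
      using assms(3) less.prems by (auto simp: partial_order_on_def preorder_on_def refl_on_def)
  next
    case False
    then obtain u where u: "(u, y) \<in> P" "u \<noteq> y" "u \<notin> set h"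
      using less.prems by (auto simp: legal_move_def)
    have tr: "Relation.trans P" and an: "antisym P" and refl: "refl_on X P"
      using assms(3) by (auto simp: partial_order_on_def preorder_on_def)
    have "{w. (w, u) \<in> P} \<subset> {w. (w, y) \<in> P}"
    proof
      show "{w. (w, u) \<in> P} \<subseteq> {w. (w, y) \<in> P}"
        using tr u(1) by (auto dest: transD)
      have "(y, y) \<in> P" "(y, u) \<notin> P"
        using refl an u less.prems by (auto simp: refl_on_def dest: antisymD)
      then show "{w. (w, u) \<in> P} \<noteq> {w. (w, y) \<in> P}"
        by auto
    qed
    moreover have "finite {w. (w, y) \<in> P}"
      using assms(1,2) by (auto intro: finite_subset[of _ X])
    ultimately have "card {w. (w, u) \<in> P} < card {w. (w, y) \<in> P}"
      by (rule psubset_card_mono[rotated])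
    moreover have "u \<in> X - set h"
      using u assms(2) by auto
    ultimately obtain z where "legal_move X P h z" "(z, u) \<in> P"
      using less.hyps by blast
    then show ?thesis
      using tr u(1) by (blast dest: transD)
  qed
qed

text \<open>Played against each other, the two strategies fill the board, and this one play would be
  won by both.\<close>

lemma not_both_win:
  assumes fin: "finite X" and "P \<subseteq> X \<times> X" and po: "partial_order_on X P"
    and M: "has_winning_strategy X F P s Maker" and B: "has_winning_strategy X F P s Breaker"
  shows False
proof -
  obtain \<sigma> where \<sigma>: "\<And>h. legal_play X P h \<Longrightarrow> follows s Maker \<sigma> h \<Longrightarrow> set h \<noteq> X \<Longrightarrow>
      mover s (length h) = Maker \<Longrightarrow> legal_move X P h (\<sigma> h)"
    "\<And>h. legal_play X P h \<Longrightarrow> follows s Maker \<sigma> h \<Longrightarrow> set h = X \<Longrightarrow> wins_play F s Maker h"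
    using M unfolding has_winning_strategy_def by blast
  obtain \<tau> where \<tau>: "\<And>h. legal_play X P h \<Longrightarrow> follows s Breaker \<tau> h \<Longrightarrow> set h \<noteq> X \<Longrightarrow>
      mover s (length h) = Breaker \<Longrightarrow> legal_move X P h (\<tau> h)"
    "\<And>h. legal_play X P h \<Longrightarrow> follows s Breaker \<tau> h \<Longrightarrow> set h = X \<Longrightarrow> wins_play F s Breaker h"
    using B unfolding has_winning_strategy_def by blast
  have "\<exists>h. length h = k \<and> legal_play X P h \<and> follows s Maker \<sigma> h \<and> follows s Breaker \<tau> h"
    if "k \<le> card X" for k
    using that
  proof (induction k)
    case 0
    then show ?case by simp
  next
    case (Suc k)
    then obtain h where h: "length h = k" "legal_play X P h" "follows s Maker \<sigma> h"
      "follows s Breaker \<tau> h"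
      by auto
    then have "set h \<noteq> X"
      using Suc.prems legal_play_distinct[OF h(2)] distinct_card by fastforce
    then show ?case
      using h \<sigma>(1)[of h] \<tau>(1)[of h]
      by (intro exI[of _ "h @ [if mover s (length h) = Maker then \<sigma> h else \<tau> h]"])
        (cases "mover s (length h)"; simp add: legal_play_snoc follows_snoc)
  qed
  then obtain h where h: "length h = card X" "legal_play X P h" "follows s Maker \<sigma> h"
      "follows s Breaker \<tau> h"
    by blast
  then have "set h = X"
    using legal_play_subset[OF h(2)] legal_play_distinct[OF h(2)] fin
    by (simp add: card_subset_eq distinct_card)
  then show False
    using \<sigma>(2)[of h] \<tau>(2)[of h] h by simp
qed

text \<open>The strategy picks at each own turn some legal move preserving \<open>I\<close>;
  induction along the play carries \<open>I\<close> to every play that follows it.\<close>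

lemma has_winning_strategy_invariant:
  assumes init: "I []"
    and own: "\<And>h. legal_play X P h \<Longrightarrow> I h \<Longrightarrow> mover s (length h) = p \<Longrightarrow> set h \<noteq> X \<Longrightarrow>
      \<exists>v. legal_move X P h v \<and> I (h @ [v])"
    and opp: "\<And>h v. legal_play X P h \<Longrightarrow> I h \<Longrightarrow> mover s (length h) \<noteq> p \<Longrightarrow>
      legal_move X P h v \<Longrightarrow> I (h @ [v])"
    and fin: "\<And>h. legal_play X P h \<Longrightarrow> I h \<Longrightarrow> set h = X \<Longrightarrow> wins_play F s p h"
  shows "has_winning_strategy X F P s p"
proof -
  define \<sigma> where "\<sigma> h = (SOME v. legal_move X P h v \<and> I (h @ [v]))" for h
  have \<sigma>: "legal_move X P h (\<sigma> h) \<and> I (h @ [\<sigma> h])"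
    if "legal_play X P h" "I h" "mover s (length h) = p" "set h \<noteq> X" for h
    unfolding \<sigma>_def by (rule someI_ex) (rule own[OF that])
  have I: "I h" if "legal_play X P h" "follows s p \<sigma> h" for h
    using that
  proof (induction h rule: rev_induct)
    case Nil
    then show ?case by (simp add: init)
  next
    case (snoc v h)
    then have h: "legal_play X P h" "I h" "legal_move X P h v"
      and v: "mover s (length h) = p \<Longrightarrow> v = \<sigma> h"
      by (auto simp: legal_play_snoc follows_snoc)
    have "set h \<noteq> X"
      using h(3) by (auto simp: legal_move_def)
    then show ?case
      using h v opp \<sigma> by blast
  qed
  show ?thesis
    unfolding has_winning_strategy_def by (intro exI[of _ \<sigma>]) (use I \<sigma> fin in blast)
qed

section \<open>Playing for a single winning vertex in height 2\<close>

lemma claimed_by_disjoint: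
  "legal_play X P h \<Longrightarrow> p \<noteq> q \<Longrightarrow> claimed_by s p h \<inter> claimed_by s q h = {}"
  using legal_play_distinct[of X P h] by (auto simp: claimed_by_def nth_eq_iff_index_eq)

lemma claimed_by_take: "claimed_by s p (take k h) \<subseteq> claimed_by s p h"
  by (auto simp: claimed_by_def)

text \<open>For Breaker: claimed sets only grow, so if Maker does not own \<open>x\<close> at the
  end, she owned it at no earlier stage.\<close>

lemma wins_play_singleton:
  assumes "legal_play X P h" "x \<in> claimed_by s p h"
  shows "wins_play {{x}} s p h"
proof (cases p)
  case Maker
  then show ?thesis
    using assms by (auto simp: maker_wins_play_def intro!: exI[of _ "length h"])
next
  case Breaker
  then show ?thesis
    using claimed_by_disjoint[OF assms(1), of Maker Breaker s] claimed_by_take[of s Maker _ h]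
      assms(2)
    by (auto simp: maker_wins_play_def)
qed

text \<open>Otherwise \<open>v\<close>, \<open>u\<close>, \<open>x\<close> form a chain of three.
  Hence the vertices strictly below \<open>x\<close> are minimal and can be claimed at any
  time.\<close>

lemma below_below_impossible:
  assumes "poset_positional_game X F P" "poset_height P \<le> 2"
    and "(v, u) \<in> P" "(u, x) \<in> P" "u \<noteq> x"
  shows "v = u"
proof (rule ccontr)
  assume "v \<noteq> u"
  have fin: "finite X" and PX: "P \<subseteq> X \<times> X" and tr: "Relation.trans P" and an: "antisym P"
    and refl: "refl_on X P"
    using assms(1) by (auto simp: poset_positional_game_def partial_order_on_def preorder_on_def)
  have "(v, x) \<in> P"
    using tr assms(3,4) by (blast dest: transD)
  moreover have "v \<noteq> x"
    using an assms(3-5) by (auto dest: antisymD)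
  moreover have "(v, v) \<in> P" "(u, u) \<in> P" "(x, x) \<in> P"
    using PX refl assms(3,4) by (auto simp: refl_on_def)
  ultimately have "{v, u, x} \<in> Chains P" "card {v, u, x} = 3"
    using assms(3-5) \<open>v \<noteq> u\<close> by (auto simp: Chains_def)
  moreover have "finite (card ` Chains P)"
  proof -
    have "C \<subseteq> X" if "C \<in> Chains P" for C
      using that PX by (auto simp: Chains_def)
    then have "Chains P \<subseteq> Pow X"
      by blast
    then show ?thesis
      using fin by (auto intro: finite_subset)
  qed
  ultimately have "3 \<le> poset_height P"
    unfolding poset_height_def by (metis Max_ge imageI)
  then show False
    using assms(2) by simp
qed

text \<open>Both players are treated at once. Maker moves after an even number of claims, so an odd
  number of vertices not above or equal to \<open>u\<close> means that Breaker is the one forced to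
  claim \<open>u\<close>. The \<open>of_bool\<close> term is the tempo: Breaker moves second and
  needs a strict majority.\<close>

lemma strategy_from_majority:
  fixes X :: "'a set"
  assumes game: "poset_positional_game X {{x}} P" and height: "poset_height P \<le> 2"
    and maj: "let D = {u. (u, x) \<in> P \<and> u \<noteq> x};
        good = (\<lambda>u. odd (card (X - P `` {u})) \<longleftrightarrow> p = Maker)
      in card {u \<in> D. \<not> good u} + of_bool (p \<noteq> Maker) \<le> card {u \<in> D. good u}"
  shows "has_winning_strategy X {{x}} P Maker p"
proof -
  have fin: "finite X" and PX: "P \<subseteq> X \<times> X" and po: "partial_order_on X P" and xX: "x \<in> X"
    and tr: "Relation.trans P" and an: "antisym P" and refl: "refl_on X P"
    using game by (auto simp: poset_positional_game_def partial_order_on_def preorder_on_def)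
  define D where "D = {u. (u, x) \<in> P \<and> u \<noteq> x}"
  define good where "good u \<longleftrightarrow> (odd (card (X - P `` {u})) \<longleftrightarrow> p = Maker)" for u
  define G where "G h = {u \<in> D - set h. good u}" for h
  define B where "B h = {u \<in> D - set h. \<not> good u}" for h
  have DX: "D \<subseteq> X" and finD: "finite D"
    using PX fin by (auto simp: D_def intro: finite_subset[of _ X])
  have [simp]: "finite (G h)" "finite (B h)" for h
    using finD by (auto simp: G_def B_def)
  have Gsnoc: "G (h @ [v]) = G h - {v}" and Bsnoc: "B (h @ [v]) = B h - {v}" for h v
    by (auto simp: G_def B_def)
  have GB: "D - set h = G h \<union> B h" "G h \<inter> B h = {}" for h
    by (auto simp: G_def B_def)
  have Dlegal: "legal_move X P h u" if "u \<in> D - set h" for h u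
    using that DX below_below_impossible[OF game height]
    unfolding legal_move_def D_def by blast
  \<comment> \<open>The inequality is strict when the opponent is to move, so the loss of one good
    vertex can be absorbed.\<close>
  define I where "I h \<longleftrightarrow> x \<in> claimed_by Maker p h \<or>
    x \<notin> set h \<and> card (B h) + of_bool (mover Maker (length h) \<noteq> p) \<le> card (G h)" for h
  show ?thesis
  proof (rule has_winning_strategy_invariant)
    show "I []"
      using maj by (auto simp: I_def G_def B_def mover_def D_def good_def Let_def)
  next
    fix h v
    assume h: "legal_play X P h" "I h" "mover Maker (length h) \<noteq> p" "legal_move X P h v"
    show "I (h @ [v])"
    proof (cases "x \<in> claimed_by Maker p h")
      case True
      then show ?thesis by (simp add: I_def claimed_by_snoc)
    next
      case False
      then have "x \<notin> set h" and less: "card (B h) < card (G h)"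
        using h by (auto simp: I_def)
      \<comment> \<open>Strictness leaves a good vertex unclaimed below \<open>x\<close>, so the
        opponent cannot take \<open>x\<close> now.\<close>
      then obtain u where "u \<in> D - set h"
        using GB(1) by (metis Un_iff card.empty ex_in_conv not_less0)
      then have "v \<noteq> x"
        using h(4) by (auto simp: legal_move_def D_def)
      moreover have "card (B (h @ [v])) \<le> card (B h)" "card (G h) \<le> Suc (card (G (h @ [v])))"
        by (auto simp: Gsnoc Bsnoc card_Diff_singleton_if card_mono)
      moreover have "mover Maker (length (h @ [v])) = p"
        using h(3) by (cases p; cases "mover Maker (length h)") (auto simp: mover_Suc)
      ultimately show ?thesis
        using less \<open>x \<notin> set h\<close> by (auto simp: I_def)
    qed
  next
    fix h
    assume h: "legal_play X P h" "I h" "mover Maker (length h) = p" "set h \<noteq> X"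
    have next_mover: "mover Maker (length (h @ [v])) \<noteq> p" for v
      using h(3) by (simp add: mover_Suc)
    obtain y where y: "y \<in> X - set h"
      using h(4) legal_play_subset[OF h(1)] by blast
    show "\<exists>v. legal_move X P h v \<and> I (h @ [v])"
    proof (cases "x \<in> claimed_by Maker p h")
      case True
      then show ?thesis
        using legal_move_below[OF fin PX po y] by (auto simp: I_def claimed_by_snoc)
    next
      case False
      then have xh: "x \<notin> set h" and le: "card (B h) \<le> card (G h)"
        using h by (auto simp: I_def)
      \<comment> \<open>With nothing left below \<open>x\<close>, claim \<open>x\<close>; otherwise
        remove a bad vertex, which makes the inequality strict. If all that remain are good, any
        move leaving one of them suffices.\<close>
      consider (exhausted) "D - set h = {}" | (bad) u where "u \<in> B h"
        | (good) "B h = {}" "D - set h \<noteq> {}"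
        by blast
      then show ?thesis
      proof cases
        case exhausted
        then have "legal_move X P h x"
          using xX xh by (auto simp: legal_move_def D_def)
        then show ?thesis
          using h(3) by (auto simp: I_def claimed_by_snoc)
      next
        case bad
        have "u \<in> D - set h" "u \<notin> G h"
          using bad by (auto simp: B_def G_def)
        moreover have "u \<noteq> x"
          using bad by (auto simp: B_def D_def)
        ultimately show ?thesis
          using bad le xh Dlegal next_mover[of u] card_gt_0_iff[of "B h"]
          by (intro exI[of _ u]) (auto simp: I_def Gsnoc Bsnoc)
      next
        case good
        then have G: "G h = D - set h" "G h \<noteq> {}"
          using GB(1)[of h] by auto
        have "\<exists>v. legal_move X P h v \<and> G h - {v} \<noteq> {}"
        proof (rule ccontr)
          assume none: "\<nexists>v. legal_move X P h v \<and> G h - {v} \<noteq> {}"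
          obtain u where u: "u \<in> G h"
            using G by blast
          have only: "v = u" if "legal_move X P h v" for v
            using none that u by blast
          \<comment> \<open>A player forced to claim the last vertex \<open>u\<close> below \<open>x\<close> finds everything claimed except
            the vertices above \<open>u\<close>, so whose turn it is would contradict \<open>good u\<close>.\<close>
          have "set h = X - P `` {u}"
          proof
            show "set h \<subseteq> X - P `` {u}"
              using legal_play_subset[OF h(1)] legal_play_down_closed[OF h(1)] u
              by (auto simp: G_def)
            \<comment> \<open>Below each unclaimed vertex there is a legal move, which can only be
              \<open>u\<close>.\<close>
            show "X - P `` {u} \<subseteq> set h"
              using only legal_move_below[OF fin PX po] by blast
          qed
          then have "length h = card (X - P `` {u})"
            using legal_play_distinct[OF h(1)] distinct_card by metis
          then show False
            using u h(3) by (cases p) (auto simp: G_def good_def mover_def split: if_splits)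
        qed
        then obtain v where v: "legal_move X P h v" "G h - {v} \<noteq> {}"
          by blast
        have "v \<noteq> x"
          using v(1) G by (auto simp: legal_move_def D_def)
        moreover have "0 < card (G h - {v})"
          using v(2) by (simp add: card_gt_0_iff)
        ultimately show ?thesis
          using v(1) good(1) xh next_mover[of v]
          by (intro exI[of _ v]) (auto simp: I_def Gsnoc Bsnoc)
      qed
    qed
  next
    fix h
    assume h: "legal_play X P h" "I h" "set h = X"
    then show "wins_play {{x}} Maker p h"
      using xX by (auto simp: I_def intro: wins_play_singleton)
  qed
qed

text \<open>For Maker, \<open>good\<close> is odd parity and a tie suffices; for Breaker it is even
  parity and must be in strict majority, which is the negation of \<open>maj\<close>.\<close>

lemma winner_iff_majority:
  fixes X :: "'a set"
  assumes game: "poset_positional_game X {{x}} P" and height: "poset_height P \<le> 2"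
  defines "D \<equiv> {u. (u, x) \<in> P \<and> u \<noteq> x}"
  defines "maj \<equiv> card {u \<in> D. even (card (X - P `` {u}))} \<le> card {u \<in> D. odd (card (X - P `` {u}))}"
  shows "has_winning_strategy X {{x}} P Maker Maker \<longleftrightarrow> maj"
    and "has_winning_strategy X {{x}} P Maker Breaker \<longleftrightarrow> \<not> maj"
proof -
  have M: "has_winning_strategy X {{x}} P Maker Maker" if maj
    using that unfolding maj_def D_def by (intro strategy_from_majority assms) simp
  have B: "has_winning_strategy X {{x}} P Maker Breaker" if "\<not> maj"
    using that unfolding maj_def D_def by (intro strategy_from_majority assms) simp
  have "\<not> (has_winning_strategy X {{x}} P Maker Maker \<and>
      has_winning_strategy X {{x}} P Maker Breaker)"
    using not_both_win game unfolding poset_positional_game_def by metis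
  then show "has_winning_strategy X {{x}} P Maker Maker \<longleftrightarrow> maj"
    "has_winning_strategy X {{x}} P Maker Breaker \<longleftrightarrow> \<not> maj"
    using M B by blast+
qed

section \<open>A Turing machine computing the majority\<close>

text \<open>Tape 0 is the input. The head of tape 1 is the current column and the head of tape 2 the
  current row; both tapes carry the characteristic vector of the winning set. State 0 reads the
  number \<open>n\<close> of vertices, marking cells on the other tapes; state 1 skips the number of winning
  sets; state 3 copies the characteristic vector; states 2 and 4 rewind tapes 1 and 2, and state 9
  rewinds tape 1 after each row. States 5 to 8 read row \<open>u\<close> of the order relation and remember the
  parity of the number of its zeros and whether \<open>(u, x) \<in> P\<close>. Exactly the cells \<open>0, \<dots>, n\<close> of tape 3
  are marked, and its head starts at \<open>n\<close>, moving left for a vertex favouring Maker and right for one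
  favouring Breaker: a blank at the end means that Breaker has the majority.\<close>

definition row_state :: "bool \<Rightarrow> bool \<Rightarrow> nat" where
  "row_state odd_zeros below = 5 + of_bool odd_zeros + 2 * of_bool below"

text \<open>In states 5 to 8 the end of a row (blank on tape 1) is tested before the end of the
  input (blank on tape 0), so the last row is still evaluated. The test \<open>c \<noteq> 2\<close>
  discards the row of \<open>x\<close>, which reflexivity would count as below
  \<open>x\<close>.\<close>

definition delta :: "nat \<Rightarrow> nat list \<Rightarrow> nat \<times> (nat \<times> move) list" where
  "delta q as = (case as of [a, b, c, d] \<Rightarrow>
     if q = 0 then
       if a = 2 then (0, [(a, Go_Right), (1, Go_Right), (1, Go_Right), (1, Go_Right)])
       else (1, [(a, Go_Right), (b, Go_Left), (c, Go_Left), (1, Stay)])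
     else if q = 1 then
       (if a = 2 then 1 else 2, [(a, Go_Right), (b, Stay), (c, Stay), (d, Stay)])
     else if q = 3 \<and> b \<noteq> 0 then (3, [(a, Go_Right), (a, Go_Right), (a, Go_Right), (d, Stay)])
     else if q = 3 then (4, [(a, Stay), (b, Go_Left), (c, Go_Left), (d, Stay)])
     else if q \<in> {2, 4} then
       if b \<noteq> 0 then (q, [(a, Stay), (b, Go_Left), (c, Go_Left), (d, Stay)])
       else (q + 1, [(a, Stay), (b, Go_Right), (c, Go_Right), (d, Stay)])
     else if q = 9 then
       if b \<noteq> 0 then (9, [(a, Stay), (b, Go_Left), (c, Stay), (d, Stay)])
       else (5, [(a, Stay), (b, Go_Right), (c, Stay), (d, Stay)])
     else if q \<in> {5..8} then
       if b = 0 then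
         (9, [(a, Stay), (b, Go_Left), (c, Go_Right),
              (d, if q \<ge> 7 \<and> c \<noteq> 2 then if even q then Go_Left else Go_Right else Stay)])
       else if a = 0 then
         (if d \<noteq> 0 then 10 else 11, [(a, Stay), (b, Stay), (c, Stay), (d, Stay)])
       else
         (row_state (even q \<noteq> (a = 1)) (q \<ge> 7 \<or> a = 2 \<and> b = 2),
          [(a, Go_Right), (b, Go_Right), (c, Stay), (d, Stay)])
     else (10, [(a, Stay), (b, Stay), (c, Stay), (d, Stay)])
   | _ \<Rightarrow> (10, []))"

definition majority_machine :: tm where
  "majority_machine = \<lparr>num_tapes = 4, num_states = 12, num_symbols = 3, start_state = 0,
     accept_state = 10, reject_state = 11, trans = delta\<rparr>"

lemma turing_machine_majority_machine: "turing_machine majority_machine"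
proof -
  have "q' < 12 \<and> length acts = 4 \<and> (\<forall>(b, m) \<in> set acts. b < 3)"
    if q: "q < 12" "delta q as = (q', acts)" and len: "length as = 4"
      and sym: "\<forall>a \<in> set as. a < 3" for q as q' acts
  proof -
    obtain a b c d where as: "as = [a, b, c, d]"
      using len by (auto simp: numeral_eq_Suc length_Suc_conv)
    then have "a < 3" "b < 3" "c < 3" "d < 3"
      using sym by auto
    moreover have "row_state y z < 12" for y z
      by (simp add: row_state_def)
    ultimately show ?thesis
      using q unfolding as delta_def by (auto split: if_splits)
  qed
  then show ?thesis
    unfolding turing_machine_def majority_machine_def by (simp del: split_paired_All) blast
qed

section \<open>Single steps and tape contents\<close>

abbreviation step :: "config \<Rightarrow> config" where
  "step \<equiv> tm_step majority_machine"

lemma step_delta: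
  "q < 10 \<Longrightarrow> step (q, [(s, i), (f, j), (g, k), (h, l)]) =
    (case delta q [s i, f j, g k, h l] of (q', acts) \<Rightarrow>
      (q', map2 act acts [(s, i), (f, j), (g, k), (h, l)]))"
  by (simp add: tm_step_def halted_def majority_machine_def)

text \<open>Words describe the contents of all four tapes; \<open>replicate m False\<close> gives a
  block of \<open>m\<close> marks.\<close>

abbreviation cells :: "bool list \<Rightarrow> int \<Rightarrow> nat" where
  "cells w \<equiv> fst (input_tape w)"

lemma cells_nth: "i < length w \<Longrightarrow> cells w (int i) = (if w ! i then 2 else 1)"
  by (simp add: input_tape_def)

lemma cells_outside: "i < 0 \<or> i \<ge> int (length w) \<Longrightarrow> cells w i = 0"
  by (auto simp: input_tape_def)

lemma cells_nonblank: "0 \<le> i \<Longrightarrow> i < int (length w) \<Longrightarrow> cells w i \<noteq> 0"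
  by (auto simp: input_tape_def)

lemma cells_snoc: "(cells w)(int (length w) := (if b then 2 else 1)) = cells (w @ [b])"
proof
  fix i show "((cells w)(int (length w) := (if b then 2 else 1))) i = cells (w @ [b]) i"
    by (cases "i = int (length w)") (auto simp: input_tape_def nth_append nat_less_iff)
qed

lemma cells_list_update:
  "m < length w \<Longrightarrow> (cells w)(int m := (if b then 2 else 1)) = cells (w[m := b])"
proof
  fix i
  assume "m < length w"
  then show "((cells w)(int m := (if b then 2 else 1))) i = cells (w[m := b]) i"
    by (cases "i = int m") (auto simp: input_tape_def nth_list_update)
qed

section \<open>The phases of the computation\<close>

lemma read_length:
  assumes "\<And>i. i < m \<Longrightarrow> s (int i) = 2"
  shows "(step ^^ m) (0, [(s, 0), (cells [], 0), (cells [], 0), (cells [], 0)]) =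
    (0, [(s, int m), (cells (replicate m False), int m), (cells (replicate m False), int m),
      (cells (replicate m False), int m)])"
  using assms
proof (induction m)
  case 0
  then show ?case by simp
next
  case (Suc m)
  have "(cells (replicate m False))(int m := 1) = cells (replicate (Suc m) False)"
    using cells_snoc[of "replicate m False" False] by (simp add: replicate_append_same)
  then show ?case
    using Suc by (simp add: step_delta delta_def fun_upd_idem add.commute)
qed

text \<open>The heads enter at cell \<open>n - 1\<close>: \<open>n\<close> steps lead to the blank
  at \<open>-1\<close>, one more back to cell 0. Only tape 1 is tested; tape 2 moves in
  parallel.\<close>

lemma rewind_two:
  assumes q: "q \<in> {2, 4}" and nb: "\<And>i. 0 \<le> i \<Longrightarrow> i < int n \<Longrightarrow> f i \<noteq> 0" and "f (-1) = 0"
  shows "(step ^^ Suc n) (q, [(s, i), (f, int n - 1), (g, int n - 1), (h, l)]) =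
    (q + 1, [(s, i), (f, 0), (g, 0), (h, l)])"
proof -
  have "(step ^^ m) (q, [(s, i), (f, int n - 1), (g, int n - 1), (h, l)]) =
      (q, [(s, i), (f, int n - 1 - int m), (g, int n - 1 - int m), (h, l)])" if "m \<le> n" for m
    using that
  proof (induction m)
    case 0
    then show ?case by simp
  next
    case (Suc m)
    then have "f (int n - 1 - int m) \<noteq> 0"
      by (intro nb) auto
    then show ?case
      using Suc q by (auto simp: step_delta delta_def fun_upd_idem algebra_simps)
  qed
  from this[of n] show ?thesis
    using q assms(3) by (auto simp: step_delta delta_def fun_upd_idem)
qed

lemma rewind_one:
  assumes nb: "\<And>i. 0 \<le> i \<Longrightarrow> i < int n \<Longrightarrow> f i \<noteq> 0" and "f (-1) = 0"
  shows "(step ^^ Suc n) (9, [(s, i), (f, int n - 1), (g, k), (h, l)]) =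
    (5, [(s, i), (f, 0), (g, k), (h, l)])"
proof -
  have "(step ^^ m) (9, [(s, i), (f, int n - 1), (g, k), (h, l)]) =
      (9, [(s, i), (f, int n - 1 - int m), (g, k), (h, l)])" if "m \<le> n" for m
    using that
  proof (induction m)
    case 0
    then show ?case by simp
  next
    case (Suc m)
    then have "f (int n - 1 - int m) \<noteq> 0"
      by (intro nb) auto
    then show ?case
      using Suc by (auto simp: step_delta delta_def fun_upd_idem algebra_simps)
  qed
  from this[of n] show ?thesis
    using assms(2) by (auto simp: step_delta delta_def fun_upd_idem)
qed

text \<open>The old word \<open>ys\<close> consists of the marks from the first phase: being
  nonblank, they tell where to stop. The additional step reads the blank behind them.\<close>

lemma copy_word:
  assumes "length ys = length xs"
    and "\<And>m. m < length xs \<Longrightarrow> s (i + int m) = (if xs ! m then 2 else 1)"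
  shows "(step ^^ Suc (length xs)) (3, [(s, i), (cells ys, 0), (cells ys, 0), (h, l)]) =
    (4, [(s, i + int (length xs)), (cells xs, int (length xs) - 1),
      (cells xs, int (length xs) - 1), (h, l)])"
proof -
  have "(step ^^ m) (3, [(s, i), (cells ys, 0), (cells ys, 0), (h, l)]) =
      (3, [(s, i + int m), (cells (take m xs @ drop m ys), int m),
        (cells (take m xs @ drop m ys), int m), (h, l)])" if "m \<le> length xs" for m
    using that
  proof (induction m)
    case 0
    then show ?case by simp
  next
    case (Suc m)
    let ?zs = "take m xs @ drop m ys"
    have "?zs[m := xs ! m] = take (Suc m) xs @ drop (Suc m) ys"
      using Suc.prems assms(1)
      by (simp add: list_update_append take_Suc_conv_app_nth Cons_nth_drop_Suc[symmetric])
    then have "(cells ?zs)(int m := (if xs ! m then 2 else 1)) =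
        cells (take (Suc m) xs @ drop (Suc m) ys)"
      using cells_list_update[of m ?zs "xs ! m"] Suc.prems assms(1) by simp
    moreover have "cells ?zs (int m) \<noteq> 0"
      using Suc.prems assms(1) by (intro cells_nonblank) auto
    ultimately show ?case
      using Suc assms(2)[of m] by (simp add: step_delta delta_def fun_upd_idem algebra_simps)
  qed
  from this[of "length xs"] show ?thesis
    using assms(1) cells_outside[of "int (length xs)" xs]
    by (simp add: step_delta delta_def fun_upd_idem)
qed

text \<open>The state holds two bits: states 6 and 8 stand for an odd number of zeros, 7 and 8 for a
  position common to \<open>row\<close> and \<open>xs\<close>.\<close>

lemma read_row:
  assumes "length row = length xs"
    and "\<And>m. m < length row \<Longrightarrow> s (i + int m) = (if row ! m then 2 else 1)"
    and "m \<le> length row"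
  shows "(step ^^ m) (5, [(s, i), (cells xs, 0), (g, k), (h, l)]) =
    (row_state (odd (length (filter Not (take m row)))) (\<exists>j < m. row ! j \<and> xs ! j),
      [(s, i + int m), (cells xs, int m), (g, k), (h, l)])"
  using assms(3)
proof (induction m)
  case 0
  then show ?case by (simp add: row_state_def)
next
  case (Suc m)
  have "cells xs (int m) = (if xs ! m then 2 else 1)"
    using Suc.prems assms(1) by (intro cells_nth) simp
  moreover have "(\<exists>j < Suc m. row ! j \<and> xs ! j) \<longleftrightarrow>
      (\<exists>j < m. row ! j \<and> xs ! j) \<or> row ! m \<and> xs ! m"
    by (auto simp: less_Suc_eq)
  ultimately show ?case
    using Suc assms(2)[of m]
    by (auto simp: step_delta delta_def fun_upd_idem row_state_def take_Suc_conv_app_nth add.assoc)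
qed

text \<open>The displacement of the head of tape 3 caused by one row.\<close>

definition row_delta :: "bool list \<Rightarrow> bool list \<Rightarrow> bool \<Rightarrow> int" where
  "row_delta xs row is_x =
     (if (\<exists>j < length row. row ! j \<and> xs ! j) \<and> \<not> is_x
      then if odd (length (filter Not row)) then -1 else 1 else 0)"

text \<open>Reading takes \<open>length xs\<close> steps, the blank behind the row one, and
  rewinding \<open>length xs + 1\<close>.\<close>

lemma process_row:
  assumes "length row = length xs" and "r < length xs"
    and "\<And>m. m < length row \<Longrightarrow> s (i + int m) = (if row ! m then 2 else 1)"
  shows "(step ^^ (2 * length xs + 2)) (5, [(s, i), (cells xs, 0), (cells xs, int r), (h, l)]) =
    (5, [(s, i + int (length xs)), (cells xs, 0), (cells xs, int (Suc r)),
      (h, l + row_delta xs row (xs ! r))])"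
proof -
  let ?n = "length xs"
  let ?c = "(9, [(s, i + int ?n), (cells xs, int ?n - 1), (cells xs, int (Suc r)),
      (h, l + row_delta xs row (xs ! r))])"
  have "(step ^^ ?n) (5, [(s, i), (cells xs, 0), (cells xs, int r), (h, l)]) =
    (row_state (odd (length (filter Not row))) (\<exists>j < ?n. row ! j \<and> xs ! j),
      [(s, i + int ?n), (cells xs, int ?n), (cells xs, int r), (h, l)])"
    using read_row[OF assms(1,3), of ?n] assms(1) by simp
  moreover have "cells xs (int ?n) = 0"
    by (rule cells_outside) simp
  moreover have "cells xs (int r) = (if xs ! r then 2 else 1)"
    by (rule cells_nth) fact
  ultimately have 1: "(step ^^ Suc ?n) (5, [(s, i), (cells xs, 0), (cells xs, int r), (h, l)]) = ?c"
    using assms(1) by (auto simp: step_delta delta_def fun_upd_idem row_state_def row_delta_def)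
  have 2: "(step ^^ Suc ?n) ?c = (5, [(s, i + int ?n), (cells xs, 0), (cells xs, int (Suc r)),
      (h, l + row_delta xs row (xs ! r))])"
    using rewind_one[of ?n "cells xs"] cells_nonblank[of _ xs] cells_outside[of "-1" xs] by simp
  have eq: "2 * ?n + 2 = Suc ?n + Suc ?n"
    by simp
  show ?thesis
    unfolding eq funpow_add comp_apply 1 2 ..
qed

lemma process_rows:
  assumes "\<And>r. r < length xs \<Longrightarrow> length (row r) = length xs"
    and "\<And>r m. r < length xs \<Longrightarrow> m < length xs \<Longrightarrow>
      s (i + int (r * length xs + m)) = (if row r ! m then 2 else 1)"
    and "r \<le> length xs"
  shows "(step ^^ (r * (2 * length xs + 2))) (5, [(s, i), (cells xs, 0), (cells xs, 0), (h, l)]) =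
    (5, [(s, i + int (r * length xs)), (cells xs, 0), (cells xs, int r),
      (h, l + (\<Sum>r<r. row_delta xs (row r) (xs ! r)))])"
  using assms(3)
proof (induction r)
  case 0
  then show ?case by simp
next
  case (Suc r)
  have "(step ^^ (2 * length xs + 2)) (5, [(s, i + int (r * length xs)), (cells xs, 0),
        (cells xs, int r), (h, l + (\<Sum>r<r. row_delta xs (row r) (xs ! r)))]) =
      (5, [(s, i + int (r * length xs) + int (length xs)), (cells xs, 0), (cells xs, int (Suc r)),
        (h, l + (\<Sum>r<r. row_delta xs (row r) (xs ! r)) + row_delta xs (row r) (xs ! r))])"
    using Suc.prems assms(1,2)[of r] by (intro process_row) (auto simp: algebra_simps)
  moreover have time: "Suc r * (2 * length xs + 2) = (2 * length xs + 2) + r * (2 * length xs + 2)"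
    by simp
  ultimately show ?case
    using Suc.IH Suc.prems unfolding time funpow_add comp_apply
    by (simp only: Suc_leD sum.lessThan_Suc add.assoc) (simp add: algebra_simps)
qed

section \<open>The complete run on an encoded game\<close>

lemma nth_concat_map:
  assumes "\<And>x. x \<in> set xs \<Longrightarrow> length (f x) = n" "r < length xs" "m < n"
  shows "concat (map f xs) ! (r * n + m) = f (xs ! r) ! m"
  using assms
proof (induction xs arbitrary: r)
  case Nil
  then show ?case by simp
next
  case (Cons x xs)
  then show ?case
    by (cases r) (auto simp: nth_append add.assoc)
qed

lemma config_after_encoding:
  fixes vs :: "'a list" and P :: "('a \<times> 'a) set"
  defines "n \<equiv> length vs"
  assumes "x \<in> set vs"
  defines "xs \<equiv> map (\<lambda>v. v \<in> {x}) vs"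
    and "row \<equiv> \<lambda>r. map (\<lambda>v. (vs ! r, v) \<in> P) vs"
    and "w \<equiv> encode_game vs [{x}] P"
  shows "fst (config_after majority_machine w (n * (2 * n + 2) + 4 * n + 7)) =
    (if (\<Sum>r<n. row_delta xs (row r) (xs ! r)) \<le> 0 then 10 else 11)"
proof -
  \<comment> \<open>The second unary number is 1, encoded as \<open>[True, False]\<close>. So the
    characteristic vector starts at cell \<open>n + 3\<close> and the matrix at
    \<open>2 * n + 3\<close>.\<close>
  have w: "w = replicate n True @ [False, True, False] @ xs @
      concat (map (\<lambda>u. map (\<lambda>v. (u, v) \<in> P) vs) vs)"
    by (simp add: w_def encode_game_def unary_def n_def xs_def)
  have lxs: "length xs = n"
    by (simp add: xs_def n_def)
  have lw: "length w = n + 3 + n + n * n"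
    by (simp add: w lxs) (simp add: length_concat o_def sum_list_triv n_def)
  have n: "n > 0"
    using assms(2) by (auto simp: n_def)
  let ?s = "cells w"
  let ?R = "\<lambda>m. cells (replicate m False)"
  let ?c = "\<lambda>q i f j g k h l. (q, [(?s, int i), (f, j), (g, k), (?R h, l)]) :: config"
  have init: "initial_config majority_machine w = ?c 0 0 (cells []) 0 (cells []) 0 0 0"
    by (simp add: initial_config_def majority_machine_def input_tape_def numeral_eq_Suc fun_eq_iff)
  have r0: "?s (int i) = 2" if "i < n" for i
  proof -
    have "w ! i" "i < length w"
      using that lw by (auto simp: w nth_append)
    then show ?thesis
      by (simp add: cells_nth)
  qed
  have r1: "?s (int n) = 1" "?s (int (n + 1)) = 2" "?s (int (n + 2)) = 1"
  proof -
    have "\<not> w ! n" "w ! (n + 1)" "\<not> w ! (n + 2)"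
      by (simp_all add: w nth_append)
    then show "?s (int n) = 1" "?s (int (n + 1)) = 2" "?s (int (n + 2)) = 1"
      using lw cells_nth[of n w] cells_nth[of "n + 1" w] cells_nth[of "n + 2" w] by simp_all
  qed
  have r2: "?s (int (n + 3) + int m) = (if xs ! m then 2 else 1)" if "m < length xs" for m
    using that lw lxs cells_nth[of "n + 3 + m" w] by (simp add: w nth_append add.assoc)
  have r3: "?s (int (2 * n + 3) + int (r * length xs + m)) = (if row r ! m then 2 else 1)"
    if "r < length xs" "m < length xs" for r m
  proof -
    have "r * n + m < n * n"
    proof -
      have "r * n + m < Suc r * n"
        using that lxs by simp
      also have "\<dots> \<le> n * n"
        using that lxs by (intro mult_right_mono) auto
      finally show ?thesis .
    qed
    moreover have "w ! (2 * n + 3 + (r * n + m)) = row r ! m"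
      using that lxs nth_concat_map[of vs "\<lambda>u. map (\<lambda>v. (u, v) \<in> P) vs" n r m]
      by (simp add: w nth_append row_def n_def)
    ultimately show ?thesis
      using lw lxs cells_nth[of "2 * n + 3 + (r * n + m)" w] by (simp add: add.assoc)
  qed
  have t1: "(step ^^ n) (initial_config majority_machine w) =
      ?c 0 n (?R n) (int n) (?R n) (int n) n (int n)"
    unfolding init using read_length[of n ?s] r0 by simp
  have mark: "(?R n)(int n := 1) = ?R (Suc n)"
    using cells_snoc[of "replicate n False" False] by (simp add: replicate_append_same)
  \<comment> \<open>Three steps: the terminator of the first unary number, then both symbols of the
    second.\<close>
  have t2: "(step ^^ 3) (?c 0 n (?R n) (int n) (?R n) (int n) n (int n)) =
      ?c 2 (n + 3) (?R n) (int n - 1) (?R n) (int n - 1) (Suc n) (int n)"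
    using r1 mark
    by (simp add: numeral_3_eq_3 step_delta delta_def fun_upd_idem add.commute add.left_commute)
  have t3: "(step ^^ Suc n) (?c 2 (n + 3) (?R n) (int n - 1) (?R n) (int n - 1) (Suc n) (int n)) =
      ?c 3 (n + 3) (?R n) 0 (?R n) 0 (Suc n) (int n)"
    by (subst rewind_two) (auto simp: input_tape_def)
  have t4: "(step ^^ Suc n) (?c 3 (n + 3) (?R n) 0 (?R n) 0 (Suc n) (int n)) =
      ?c 4 (2 * n + 3) (cells xs) (int n - 1) (cells xs) (int n - 1) (Suc n) (int n)"
    using copy_word[of "replicate n False" xs ?s "int (n + 3)"] r2 lxs
    by (simp add: algebra_simps)
  have t5: "(step ^^ Suc n) (?c 4 (2 * n + 3) (cells xs) (int n - 1) (cells xs) (int n - 1)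
        (Suc n) (int n)) =
      ?c 5 (2 * n + 3) (cells xs) 0 (cells xs) 0 (Suc n) (int n)"
    by (subst rewind_two) (auto simp: input_tape_def lxs)
  define \<Delta> where "\<Delta> = (\<Sum>r<n. row_delta xs (row r) (xs ! r))"
  have t6: "(step ^^ (n * (2 * n + 2))) (?c 5 (2 * n + 3) (cells xs) 0 (cells xs) 0 (Suc n) (int n)) =
      ?c 5 (2 * n + 3 + n * n) (cells xs) 0 (cells xs) (int n) (Suc n) (int n + \<Delta>)"
    using process_rows[of xs row ?s "int (2 * n + 3)" n] r3 lxs
    by (simp add: row_def n_def \<Delta>_def add.assoc)
  \<comment> \<open>Each row moves the head by at most one cell, so it cannot leave the marked cells
    \<open>0\<close> to \<open>n\<close> on the left; a blank is reached only by
    \<open>\<Delta> > 0\<close>.\<close>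
  have "\<bar>\<Delta>\<bar> \<le> (\<Sum>r<n. 1)"
    unfolding \<Delta>_def by (rule order.trans[OF sum_abs sum_mono]) (simp add: row_delta_def)
  then have "?R (Suc n) (int n + \<Delta>) \<noteq> 0 \<longleftrightarrow> \<Delta> \<le> 0"
    by (auto simp: input_tape_def)
  moreover have "?s (int (2 * n + 3 + n * n)) = 0"
    using lw by (intro cells_outside) simp
  \<comment> \<open>The board contains \<open>x\<close>, so column 0 exists and state 5 proceeds to
    the test for the end of the input.\<close>
  moreover have "cells xs 0 \<noteq> 0"
    using n lxs by (intro cells_nonblank) auto
  ultimately have t7: "fst ((step ^^ 1)
      (?c 5 (2 * n + 3 + n * n) (cells xs) 0 (cells xs) (int n) (Suc n) (int n + \<Delta>))) =
      (if \<Delta> \<le> 0 then 10 else 11)"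
    by (simp add: step_delta delta_def fun_upd_idem)
  \<comment> \<open>The summands are the phase lengths, last phase first, since
    \<open>funpow_add\<close> applies the right summand first.\<close>
  have time: "n * (2 * n + 2) + 4 * n + 7 =
      1 + (n * (2 * n + 2) + (Suc n + (Suc n + (Suc n + (3 + n)))))"
    by simp
  show ?thesis
    unfolding config_after_def time funpow_add comp_apply t1 t2 t3 t4 t5 t6 t7 \<Delta>_def[symmetric] ..
qed

section \<open>Halting, and the final count as a majority\<close>

lemma halted_funpow: "halted M c \<Longrightarrow> (tm_step M ^^ t) c = c"
  by (induction t) (simp_all add: tm_step_def)

lemma config_after_halted:
  assumes "halts_within M w t" "t \<le> t'"
  shows "config_after M w t' = config_after M w t"
proof -
  have "config_after M w t' = (tm_step M ^^ (t' - t)) (config_after M w t)"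
    using assms(2) funpow_add[of "t' - t" t "tm_step M"] by (simp add: config_after_def)
  then show ?thesis
    using assms(1) by (simp add: halted_funpow halts_within_def)
qed

text \<open>Acceptance and rejection quantify over all times, but halted configurations are
  stationary, so all halting times show the same configuration.\<close>

lemma halting_outcome:
  assumes "accept_state M \<noteq> reject_state M" "halts_within M w t"
  shows "accepts M w \<longleftrightarrow> fst (config_after M w t) = accept_state M"
    and "rejects M w \<longleftrightarrow> fst (config_after M w t) = reject_state M"
proof -
  have same: "config_after M w t' = config_after M w t"
    if "halts_within M w t'" for t'
    using config_after_halted[OF assms(2), of t'] config_after_halted[OF that, of t]
    by (metis nat_le_linear)
  show "accepts M w \<longleftrightarrow> fst (config_after M w t) = accept_state M"
    using same unfolding accepts_def halts_within_def halted_def by fastforce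
  show "rejects M w \<longleftrightarrow> fst (config_after M w t) = reject_state M"
    using same unfolding rejects_def halts_within_def halted_def by fastforce
qed

text \<open>The zeros of row \<open>u\<close> are the vertices not above or equal to
  \<open>u\<close>, and the winning column holds the bit \<open>(u, x) \<in> P\<close>; summing over
  indices is summing over vertices because \<open>vs\<close> is distinct.\<close>

lemma sum_row_delta:
  fixes vs :: "'a list" and P :: "('a \<times> 'a) set"
  assumes "distinct vs" "x \<in> set vs" and PX: "P \<subseteq> set vs \<times> set vs"
  defines "D \<equiv> {u. (u, x) \<in> P \<and> u \<noteq> x}"
  shows "(\<Sum>r<length vs. row_delta (map (\<lambda>v. v \<in> {x}) vs) (map (\<lambda>v. (vs ! r, v) \<in> P) vs)
      (map (\<lambda>v. v \<in> {x}) vs ! r)) =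
    int (card {u \<in> D. even (card (set vs - P `` {u}))}) -
    int (card {u \<in> D. odd (card (set vs - P `` {u}))})" (is "?lhs = _")
proof -
  let ?sign = "\<lambda>u. if u \<in> D then if odd (card (set vs - P `` {u})) then -1 else 1 else 0 :: int"
  have zeros: "length (filter Not (map (\<lambda>v. (u, v) \<in> P) vs)) = card (set vs - P `` {u})" for u
  proof -
    have "length (filter Not (map (\<lambda>v. (u, v) \<in> P) vs)) = length (filter (\<lambda>v. (u, v) \<notin> P) vs)"
      by (simp add: filter_map o_def)
    also have "\<dots> = card (set (filter (\<lambda>v. (u, v) \<notin> P) vs))"
      using assms(1) by (simp add: distinct_card del: set_filter)
    also have "set (filter (\<lambda>v. (u, v) \<notin> P) vs) = set vs - P `` {u}"
      by auto
    finally show ?thesis .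
  qed
  obtain k where k: "k < length vs" "vs ! k = x"
    using assms(2) by (auto simp: in_set_conv_nth)
  have below: "(\<exists>j < length (map (\<lambda>v. (u, v) \<in> P) vs). map (\<lambda>v. (u, v) \<in> P) vs ! j \<and>
      map (\<lambda>v. v \<in> {x}) vs ! j) \<longleftrightarrow> (u, x) \<in> P" for u
    using k by auto
  have "?lhs = (\<Sum>r<length vs. ?sign (vs ! r))"
    unfolding row_delta_def zeros below by (intro sum.cong) (auto simp: D_def)
  also have "\<dots> = (\<Sum>u\<in>set vs. ?sign u)"
    using sum.reindex_bij_betw[OF bij_betw_nth[OF assms(1) refl refl], of ?sign] .
  also have "\<dots> = (\<Sum>u\<in>D. if odd (card (set vs - P `` {u})) then -1 else 1)"
    using PX by (intro sum.mono_neutral_cong_right) (auto simp: D_def)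
  also have "\<dots> = int (card {u \<in> D. even (card (set vs - P `` {u}))}) -
      int (card {u \<in> D. odd (card (set vs - P `` {u}))})"
  proof -
    have "finite D"
      using PX by (auto simp: D_def intro: finite_subset[of _ "set vs"])
    then show ?thesis
      by (simp add: sum.If_cases Int_def)
  qed
  finally show ?thesis .
qed

theorem theorem1:
  shows "\<exists>M (p :: nat poly). turing_machine M \<and>
    (\<forall>(X :: nat set) F P x w.
       poset_positional_game X F P \<and> poset_height P \<le> 2 \<and> F = {{x}} \<and> game_encoding X F P w \<longrightarrow>
         halts_within M w (poly p (length w)) \<and>
         (accepts M w \<longleftrightarrow> has_winning_strategy X F P Maker Maker) \<and>
         (rejects M w \<longleftrightarrow> has_winning_strategy X F P Maker Breaker))"
proof (intro exI[of _ majority_machine] exI[of _ "[:0, 4:] :: nat poly"] conjI allI impI)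
  show "turing_machine majority_machine"
    by (rule turing_machine_majority_machine)
next
  fix X :: "nat set" and F P x w
  assume "poset_positional_game X F P \<and> poset_height P \<le> 2 \<and> F = {{x}} \<and> game_encoding X F P w"
  then have game: "poset_positional_game X {{x}} P" and height: "poset_height P \<le> 2"
    and F: "F = {{x}}" and enc: "game_encoding X {{x}} P w"
    by auto
  obtain vs Ws where vs: "distinct vs" "set vs = X" and Ws: "distinct Ws" "set Ws = {{x}}"
    and enc_eq: "w = encode_game vs Ws P"
    using enc by (auto simp: game_encoding_def)
  have "length Ws = Suc 0"
    using distinct_card[OF Ws(1)] Ws(2) by simp
  with Ws(2) have "Ws = [{x}]"
    by (cases Ws) auto
  then have w: "w = encode_game vs [{x}] P"
    by (simp only: enc_eq)
  have xX: "x \<in> set vs" and PX: "P \<subseteq> set vs \<times> set vs"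
    using game vs(2) by (auto simp: poset_positional_game_def)
  define n where "n = length vs"
  define T where "T = n * (2 * n + 2) + 4 * n + 7"
  define maj where "maj \<longleftrightarrow>
    card {u \<in> {u. (u, x) \<in> P \<and> u \<noteq> x}. even (card (X - P `` {u}))} \<le>
    card {u \<in> {u. (u, x) \<in> P \<and> u \<noteq> x}. odd (card (X - P `` {u}))}"
  have result: "fst (config_after majority_machine w T) = (if maj then 10 else 11)"
    unfolding T_def n_def w config_after_encoding[OF xX] sum_row_delta[OF vs(1) xX PX] maj_def vs(2)
    by simp
  then have halts: "halts_within majority_machine w T"
    by (simp add: halts_within_def halted_def majority_machine_def)
  have "length w = n * n + 2 * n + 3"
    by (simp add: w encode_game_def unary_def length_concat o_def sum_list_triv n_def)
  \<comment> \<open>Here \<open>T\<close> is \<open>2 * n * n + 6 * n + 7\<close>, at most four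
    times the input length.\<close>
  then have "T \<le> poly [:0, 4:] (length w)"
    by (simp add: T_def algebra_simps)
  from config_after_halted[OF halts this]
  show "halts_within majority_machine w (poly [:0, 4:] (length w))"
    using halts by (simp add: halts_within_def)
  show "accepts majority_machine w \<longleftrightarrow> has_winning_strategy X F P Maker Maker"
    "rejects majority_machine w \<longleftrightarrow> has_winning_strategy X F P Maker Breaker"
    using halting_outcome[OF _ halts] result winner_iff_majority[OF game height]
    unfolding F maj_def[symmetric] by (auto simp: majority_machine_def)
qed

end
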